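(* Let $A$ and $B$ be semirings, and let $(\Phi,D)$ and $(\Psi,D)$ be the valuation algebras induced by $A$ and $B$ respectively (over the same finite set $r$ of variables with the same frames, $D=\mathcal P(r)$). If there is a semiring isomorphism $f:A\to B$, then $(\Phi,D)$ is isomorphic to $(\Psi,D)$ as a valuation algebra.
   Context: Semirings: a semiring $\langle A,+,\times\rangle$ has two commutative and associative binary operations with $\times$ distributing over $+$, a zero element $0$ ($0+a=a$ and $0\times a=0$ for all $a$) and a unit element $1$ ($1\times a=a$ for all $a$). A semiring homomorphism preserves $+$, $\times$, $0$ and $1$; a semiring isomorphism is a bijective semiring homomorphism. Variables and configurations: $r$ is a non-empty finite set of variables; each variable $X\in r$ has a finite set $\Omega_X$ of values (its frame), and at least one frame has at least two elements. $D=\mathcal P(r)$. For $s\subseteq r$, $\Omega_s=\prod_{X\in s}\Omega_X$, with $\Omega_\emptyset=\{\epsilon\}$ a singleton. For $\mathbf x\in\Omega_s$ and $t\subseteq s$, $\mathbf x^{\downarrow t}\in\Omega_t$ denotes the projection (restriction) of $\mathbf x$ to $t$. Induced valuation algebra: given a semiring $A$, a valuation with domain $d(\phi)=s\subseteq r$ is a function $\phi:\Omega_s\to A$ (the domain $s$ is part of the data). $\Phi$ is the set of all valuations for all $s\subseteq r$, and $\Phi_s$ the set of those with domain $s$. Combination: $d(\phi\otimes\psi)=d(\phi)\cup d(\psi)$ and $(\phi\otimes\psi)(\mathbf x)=\phi(\mathbf x^{\downarrow d(\phi)})\times\psi(\mathbf x^{\downarrow d(\psi)})$. Marginalization, for $t\subseteq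 d(\phi)=s$: $\phi^{\downarrow t}\in\Phi_t$ with $\phi^{\downarrow t}(\mathbf x)=\sum_{\mathbf z\in\Omega_s,\ \mathbf z^{\downarrow t}=\mathbf x}\phi(\mathbf z)$. Neutral elements: $e_s\in\Phi_s$ is the constant function $1$. The pair $(\Phi,D)$ with these operations is the valuation algebra induced by $A$. A map $h:\Phi\to\Psi$ is a homomorphism of valuation algebras $(\Phi,D)\to(\Psi,D)$ if $h(\phi_1\otimes\phi_2)=h(\phi_1)\otimes h(\phi_2)$ for all $\phi_1,\phi_2$; $h(\phi^{\downarrow x})=h(\phi)^{\downarrow x}$ whenever $x\subseteq d(\phi)$ (this includes that $x\subseteq d(h(\phi))$, so that the right-hand side is defined); and $h(e_x)=e_x$ for all $x\in D$. An isomorphism is a bijective homomorphism. *)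

theory Defs
  imports "HOL-Algebra.Ring" "HOL-Library.FuncSet"
begin

(* The library's semiring locale leaves multiplication non-commutative.
   The case \<zero> = \<one> is allowed. *)
locale comm_semiring = semiring R + comm_monoid R for R (structure)

(* ring_hom preserves +, * and 1; without subtraction, preservation of 0 is a separate
   requirement. *)
definition semiring_hom ::
  "('a, 'm) ring_scheme \<Rightarrow> ('b, 'n) ring_scheme \<Rightarrow> ('a \<Rightarrow> 'b) set" where
  "semiring_hom A B = {f \<in> ring_hom A B. f \<zero>\<^bsub>A\<^esub> = \<zero>\<^bsub>B\<^esub>}"

definition semiring_iso ::
  "('a, 'm) ring_scheme \<Rightarrow> ('b, 'n) ring_scheme \<Rightarrow> ('a \<Rightarrow> 'b) set" where
  "semiring_iso A B = {f \<in> semiring_hom A B. bij_betw f (carrier A) (carrier B)}"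

(* The signature of a valuation algebra over sets of variables of type 'v.
   va_marg \<phi> t is meaningful only for t \<subseteq> va_label \<phi>. *)
record ('v, 'p) valuation_algebra =
  va_carrier :: "'p set"
  va_domains :: "'v set set"
  va_label :: "'p \<Rightarrow> 'v set"
  va_combine :: "'p \<Rightarrow> 'p \<Rightarrow> 'p"
  va_marg :: "'p \<Rightarrow> 'v set \<Rightarrow> 'p"
  va_neutral :: "'v set \<Rightarrow> 'p"

definition va_hom ::
  "('v, 'p) valuation_algebra \<Rightarrow> ('v, 'q) valuation_algebra \<Rightarrow> ('p \<Rightarrow> 'q) set" where
  "va_hom V W = {h \<in> va_carrier V \<rightarrow> va_carrier W.
     va_domains V = va_domains W \<and>
     (\<forall>\<phi>\<in>va_carrier V. \<forall>\<psi>\<in>va_carrier V.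
        h (va_combine V \<phi> \<psi>) = va_combine W (h \<phi>) (h \<psi>)) \<and>
     (\<forall>\<phi>\<in>va_carrier V. \<forall>x\<in>va_domains V. x \<subseteq> va_label V \<phi> \<longrightarrow>
        x \<subseteq> va_label W (h \<phi>) \<and> h (va_marg V \<phi> x) = va_marg W (h \<phi>) x) \<and>
     (\<forall>x\<in>va_domains V. h (va_neutral V x) = va_neutral W x)}"

definition va_iso ::
  "('v, 'p) valuation_algebra \<Rightarrow> ('v, 'q) valuation_algebra \<Rightarrow> ('p \<Rightarrow> 'q) set" where
  "va_iso V W = {h \<in> va_hom V W. bij_betw h (va_carrier V) (va_carrier W)}"

definition va_isomorphic ::
  "('v, 'p) valuation_algebra \<Rightarrow> ('v, 'q) valuation_algebra \<Rightarrow> bool" where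
  "va_isomorphic V W \<longleftrightarrow> va_iso V W \<noteq> {}"

(* Frames need not be non-empty. *)
locale variable_frames =
  fixes r :: "'v set" and \<Omega> :: "'v \<Rightarrow> 'w set"
  assumes finite_variables: "finite r"
    and variables_nonempty: "r \<noteq> {}"
    and finite_frames: "\<And>X. X \<in> r \<Longrightarrow> finite (\<Omega> X)"
    and nontrivial_frame: "\<exists>X\<in>r. 2 \<le> card (\<Omega> X)"

(* Configurations are extensional functions, so the projection of x to t is restrict x t,
   and the only configuration over {} is (\<lambda>_. undefined). *)
definition configs :: "('v \<Rightarrow> 'w set) \<Rightarrow> 'v set \<Rightarrow> ('v \<Rightarrow> 'w) set" where
  "configs \<Omega> s = (\<Pi>\<^sub>E X\<in>s. \<Omega> X)"

(* A valuation carries its domain as first component; the second is extensional on configs. *)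
type_synonym ('v, 'w, 'a) valuation = "'v set \<times> (('v \<Rightarrow> 'w) \<Rightarrow> 'a)"

definition valuations ::
  "('a, 'm) ring_scheme \<Rightarrow> 'v set \<Rightarrow> ('v \<Rightarrow> 'w set) \<Rightarrow> ('v, 'w, 'a) valuation set" where
  "valuations A r \<Omega> = (SIGMA s:Pow r. configs \<Omega> s \<rightarrow>\<^sub>E carrier A)"

definition val_combine ::
  "('a, 'm) ring_scheme \<Rightarrow> ('v \<Rightarrow> 'w set) \<Rightarrow>
     ('v, 'w, 'a) valuation \<Rightarrow> ('v, 'w, 'a) valuation \<Rightarrow> ('v, 'w, 'a) valuation" where
  "val_combine A \<Omega> \<phi> \<psi> =
     (fst \<phi> \<union> fst \<psi>,
      \<lambda>x\<in>configs \<Omega> (fst \<phi> \<union> fst \<psi>).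
        snd \<phi> (restrict x (fst \<phi>)) \<otimes>\<^bsub>A\<^esub> snd \<psi> (restrict x (fst \<psi>)))"

definition val_marg ::
  "('a, 'm) ring_scheme \<Rightarrow> ('v \<Rightarrow> 'w set) \<Rightarrow>
     ('v, 'w, 'a) valuation \<Rightarrow> 'v set \<Rightarrow> ('v, 'w, 'a) valuation" where
  "val_marg A \<Omega> \<phi> t =
     (t, \<lambda>x\<in>configs \<Omega> t.
           \<Oplus>\<^bsub>A\<^esub>z\<in>{z \<in> configs \<Omega> (fst \<phi>). restrict z t = x}. snd \<phi> z)"

definition val_neutral ::
  "('a, 'm) ring_scheme \<Rightarrow> ('v \<Rightarrow> 'w set) \<Rightarrow> 'v set \<Rightarrow> ('v, 'w, 'a) valuation" where
  "val_neutral A \<Omega> s = (s, \<lambda>x\<in>configs \<Omega> s. \<one>\<^bsub>A\<^esub>)"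

definition induced_valuation_algebra ::
  "('a, 'm) ring_scheme \<Rightarrow> 'v set \<Rightarrow> ('v \<Rightarrow> 'w set) \<Rightarrow>
     ('v, ('v, 'w, 'a) valuation) valuation_algebra" where
  "induced_valuation_algebra A r \<Omega> =
     \<lparr>va_carrier = valuations A r \<Omega>,
      va_domains = Pow r,
      va_label = fst,
      va_combine = val_combine A \<Omega>,
      va_marg = val_marg A \<Omega>,
      va_neutral = val_neutral A \<Omega>\<rparr>"

end

theory Submission
  imports Defs
begin

text \<open>Apply \<open>f\<close> to the values of a valuation and leave its domain alone; this is
  \<open>val_map\<close>. Combination, marginalization and neutral elements are built configuration
  by configuration from products, finite sums and \<open>\<one>\<close>, all of which
  \<open>f\<close> preserves, so \<open>val_map\<close> commutes with them
  (\<open>val_map_combine\<close>, \<open>val_map_marg\<close>, \<open>val_map_neutral\<close>).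
  Applying the inverse of \<open>f\<close> to the values undoes it, which gives bijectivity
  (\<open>bij_betw_val_map\<close>).\<close>

lemma (in variable_frames) finite_configs:
  assumes "s \<subseteq> r"
  shows "finite (configs \<Omega> s)"
  unfolding configs_def
  using assms finite_variables finite_frames by (intro finite_PiE) (auto intro: finite_subset)

lemma restrict_in_configs:
  assumes "x \<in> configs \<Omega> s" and "t \<subseteq> s"
  shows "restrict x t \<in> configs \<Omega> t"
  using assms unfolding configs_def by (auto simp: PiE_iff)

text \<open>Additivity of \<open>f\<close> drives the induction, and the empty sum is where
  preservation of \<open>\<zero>\<close> enters. Empty sums do occur in marginals: if a frame is
  empty, a configuration may have no extension to the larger domain.\<close>

lemma semiring_hom_finsum:
  assumes "semiring A" and "semiring B" and f: "f \<in> semiring_hom A B"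
    and "finite S" and "g \<in> S \<rightarrow> carrier A"
  shows "f (\<Oplus>\<^bsub>A\<^esub>z\<in>S. g z) = (\<Oplus>\<^bsub>B\<^esub>z\<in>S. f (g z))"
  using assms(4,5)
proof (induction S rule: finite_induct)
  case empty
  interpret A: semiring A by fact
  interpret B: semiring B by fact
  show ?case using f by (simp add: semiring_hom_def)
next
  case (insert x S)
  interpret A: semiring A by fact
  interpret B: semiring B by fact
  have hom: "f \<in> ring_hom A B" using f by (simp add: semiring_hom_def)
  have g: "g \<in> S \<rightarrow> carrier A" "g x \<in> carrier A" using insert.prems by auto
  have fg: "(\<lambda>z. f (g z)) \<in> S \<rightarrow> carrier B" "f (g x) \<in> carrier B"
    using g ring_hom_closed[OF hom] by auto
  show ?case
    using insert g fg by (simp add: ring_hom_add[OF hom])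
qed

text \<open>Plain composition with \<open>f\<close> would send arguments outside
  \<open>configs\<close> to \<open>f undefined\<close>; cutting it back to \<open>configs\<close>
  keeps the result extensional, hence a valuation.\<close>

definition val_map ::
  "('v \<Rightarrow> 'w set) \<Rightarrow> ('a \<Rightarrow> 'b) \<Rightarrow> ('v, 'w, 'a) valuation \<Rightarrow> ('v, 'w, 'b) valuation" where
  "val_map \<Omega> f \<phi> = (fst \<phi>, \<lambda>x\<in>configs \<Omega> (fst \<phi>). f (snd \<phi> x))"

lemma valuations_iff:
  "\<phi> \<in> valuations A r \<Omega> \<longleftrightarrow> fst \<phi> \<subseteq> r \<and> snd \<phi> \<in> configs \<Omega> (fst \<phi>) \<rightarrow>\<^sub>E carrier A"
  unfolding valuations_def by (cases \<phi>) auto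

lemma valuation_closed:
  assumes "\<phi> \<in> valuations A r \<Omega>" and "x \<in> configs \<Omega> (fst \<phi>)"
  shows "snd \<phi> x \<in> carrier A"
  using assms PiE_mem[of "snd \<phi>" "configs \<Omega> (fst \<phi>)" "\<lambda>_. carrier A" x]
  by (simp add: valuations_iff)

lemma val_map_in_valuations:
  assumes "f \<in> carrier A \<rightarrow> carrier B" and "\<phi> \<in> valuations A r \<Omega>"
  shows "val_map \<Omega> f \<phi> \<in> valuations B r \<Omega>"
  using assms unfolding valuations_iff val_map_def by (auto simp: PiE_iff Pi_iff)

lemma val_map_inverse:
  assumes "\<And>a. a \<in> carrier A \<Longrightarrow> g (f a) = a" and "\<phi> \<in> valuations A r \<Omega>"
  shows "val_map \<Omega> g (val_map \<Omega> f \<phi>) = \<phi>"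
proof (rule prod_eqI)
  show "fst (val_map \<Omega> g (val_map \<Omega> f \<phi>)) = fst \<phi>" by (simp add: val_map_def)
  \<comment> \<open>Outside \<open>configs\<close> the double image is \<open>undefined\<close> by
    construction, so equality of functions there rests on the extensionality of
    \<open>\<phi>\<close>.\<close>
  have "snd \<phi> x = undefined" if "x \<notin> configs \<Omega> (fst \<phi>)" for x
    using assms(2) that
      PiE_arb[of "snd \<phi>" "configs \<Omega> (fst \<phi>)" "\<lambda>_. carrier A" x]
    by (simp add: valuations_iff)
  then show "snd (val_map \<Omega> g (val_map \<Omega> f \<phi>)) = snd \<phi>"
    by (simp add: val_map_def fun_eq_iff assms(1) valuation_closed[OF assms(2)])
qed

lemma bij_betw_val_map:
  assumes "bij_betw f (carrier A) (carrier B)"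
  shows "bij_betw (val_map \<Omega> f) (valuations A r \<Omega>) (valuations B r \<Omega>)"
proof -
  let ?g = "inv_into (carrier A) f"
  have f: "f \<in> carrier A \<rightarrow> carrier B" and g: "?g \<in> carrier B \<rightarrow> carrier A"
    using assms bij_betw_inv_into[OF assms] by (auto dest: bij_betwE)
  show ?thesis
    \<comment> \<open>\<open>val_map_inverse\<close> serves for both composites, once with
      \<open>f\<close> and \<open>?g\<close> exchanged.\<close>
    by (rule bij_betw_byWitness[where f' = "val_map \<Omega> ?g"])
      (use f g assms in \<open>auto intro!: val_map_in_valuations val_map_inverse
        simp: bij_betw_inv_into_left bij_betw_inv_into_right\<close>)
qed

lemma val_map_combine:
  assumes f: "f \<in> ring_hom A B"
    and "\<phi> \<in> valuations A r \<Omega>" and "\<psi> \<in> valuations A r \<Omega>"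
  shows "val_map \<Omega> f (val_combine A \<Omega> \<phi> \<psi>) =
    val_combine B \<Omega> (val_map \<Omega> f \<phi>) (val_map \<Omega> f \<psi>)"
proof -
  have "f (snd \<phi> (restrict x (fst \<phi>)) \<otimes>\<^bsub>A\<^esub> snd \<psi> (restrict x (fst \<psi>))) =
      f (snd \<phi> (restrict x (fst \<phi>))) \<otimes>\<^bsub>B\<^esub> f (snd \<psi> (restrict x (fst \<psi>)))"
    if "x \<in> configs \<Omega> (fst \<phi> \<union> fst \<psi>)" for x
  proof (rule ring_hom_mult[OF f])
    show "snd \<phi> (restrict x (fst \<phi>)) \<in> carrier A"
      using assms(2) restrict_in_configs[OF that] by (simp add: valuation_closed)
    show "snd \<psi> (restrict x (fst \<psi>)) \<in> carrier A"
      using assms(3) restrict_in_configs[OF that] by (simp add: valuation_closed)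
  qed
  \<comment> \<open>Projections of a configuration are configurations by
    \<open>restrict_in_configs\<close>, so the cut-offs inside the two images on the right
    disappear.\<close>
  then show ?thesis
    by (auto simp: val_map_def val_combine_def restrict_in_configs intro!: restrict_ext)
qed

text \<open>Since \<open>val_map\<close> keeps the domain, both marginals sum over the same fibres
  of the projection to \<open>t\<close>. These are finite, so \<open>semiring_hom_finsum\<close>
  moves \<open>f\<close> inside the sum.\<close>

lemma (in variable_frames) val_map_marg:
  assumes A: "semiring A" and B: "semiring B" and f: "f \<in> semiring_hom A B"
    and \<phi>: "\<phi> \<in> valuations A r \<Omega>"
  shows "val_map \<Omega> f (val_marg A \<Omega> \<phi> t) = val_marg B \<Omega> (val_map \<Omega> f \<phi>) t"
proof -
  interpret B: semiring B by fact
  let ?S = "\<lambda>x. {z \<in> configs \<Omega> (fst \<phi>). restrict z t = x}"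
  have fin: "finite (?S x)" for x
    using \<phi> finite_configs[of "fst \<phi>"] by (simp add: valuations_iff)
  have val: "snd \<phi> \<in> ?S x \<rightarrow> carrier A" for x
    using valuation_closed[OF \<phi>] by auto
  have fval: "(\<lambda>z. f (snd \<phi> z)) \<in> ?S x \<rightarrow> carrier B" for x
    using val[of x] f by (auto simp: semiring_hom_def dest: ring_hom_closed)
  \<comment> \<open>The summand on the right keeps the \<open>restrict\<close> that unfolding
    \<open>val_map\<close> produces; it is harmless because each fibre lies in
    \<open>configs \<Omega> (fst \<phi>)\<close>.\<close>
  have "f (\<Oplus>\<^bsub>A\<^esub>z\<in>?S x. snd \<phi> z) =
      (\<Oplus>\<^bsub>B\<^esub>z\<in>?S x. restrict (\<lambda>z. f (snd \<phi> z)) (configs \<Omega> (fst \<phi>)) z)" for x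
    unfolding semiring_hom_finsum[OF A B f fin val]
    by (rule B.finsum_cong') (use fval[of x] in auto)
  then show ?thesis
    by (auto simp: val_map_def val_marg_def intro!: restrict_ext)
qed

lemma val_map_neutral:
  assumes "f \<in> ring_hom A B"
  shows "val_map \<Omega> f (val_neutral A \<Omega> s) = val_neutral B \<Omega> s"
  using ring_hom_one[OF assms] by (auto simp: val_map_def val_neutral_def intro!: restrict_ext)

theorem theorem1:
  fixes A :: "('a, 'm) ring_scheme" and B :: "('b, 'n) ring_scheme"
    and r :: "'v set" and \<Omega> :: "'v \<Rightarrow> 'w set" and f :: "'a \<Rightarrow> 'b"
  assumes "comm_semiring A" and "comm_semiring B"
    and "variable_frames r \<Omega>"
    and "f \<in> semiring_iso A B"
  shows "va_isomorphic (induced_valuation_algebra A r \<Omega>) (induced_valuation_algebra B r \<Omega>)"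
proof -
  interpret variable_frames r \<Omega> by fact
  have A: "semiring A" and B: "semiring B"
    using assms(1,2) by (auto simp: comm_semiring_def)
  have f: "f \<in> semiring_hom A B" and hom: "f \<in> ring_hom A B"
    and bij: "bij_betw f (carrier A) (carrier B)"
    using assms(4) by (auto simp: semiring_iso_def semiring_hom_def)
  have "f \<in> carrier A \<rightarrow> carrier B" using bij by (auto dest: bij_betwE)
  then have "val_map \<Omega> f \<in> va_hom (induced_valuation_algebra A r \<Omega>) (induced_valuation_algebra B r \<Omega>)"
    by (auto simp: va_hom_def induced_valuation_algebra_def val_map_in_valuations
        val_map_combine[OF hom] val_map_marg[OF A B f] val_map_neutral[OF hom])
      \<comment> \<open>Unfolding \<open>val_map\<close> shows that the label is unchanged, as the
        inclusion in the marginalization clause of \<open>va_hom\<close> requires.\<close>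
      (auto simp: val_map_def)
  then have "val_map \<Omega> f \<in> va_iso (induced_valuation_algebra A r \<Omega>) (induced_valuation_algebra B r \<Omega>)"
    using bij_betw_val_map[OF bij] by (simp add: va_iso_def induced_valuation_algebra_def)
  then show ?thesis by (auto simp: va_isomorphic_def)
qed

end
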